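(* Let $n\ge2$ be even and let $F_n$ be the Fourier matrix of order $n$. Then: 1. $F_n\in\mathcal{A}^{(1)}(n,n)$. 2. If $n=2d$ where $d$ is an odd number, then $F_n\in\mathcal{A}^{(2)}(n,n)$.
   Context: The Fourier matrix $F_n$ is the $n\times n$ matrix with entries $[F_n]_{ij}=e^{2\pi\mathbf{i}(i-1)(j-1)/n}$, where $\mathbf{i}^2=-1$. A Butson matrix $BH(m,n)$ is an $n\times n$ matrix $M$ whose entries are complex $m$-th roots of unity and which satisfies $MM^*=nI_n$, where $M^*$ is the conjugate transpose. It is normalized if its first row and first column consist entirely of ones. $\mathcal{BH}(m,n)$ is the set of all normalized $BH(m,n)$ matrices. For even $m,n$: $\mathcal{A}^{(1)}(m,n)$ is the set of $M\in\mathcal{BH}(m,n)$ that have a row $(x_1\;x_2\;\dots\;x_n)$ such that $(x_1\;-x_2\;x_3\;\dots\;x_{n-1}\;-x_n)$ (signs alternating) is also a row of $M$. $\mathcal{A}^{(2)}(m,n)$ is the set of $M\in\mathcal{BH}(m,n)$ that have a row and a column, both with all entries in $\{1,-1\}$, whose common entry is $-1$. *)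

theory Defs
  imports Complex_Main "Jordan_Normal_Form.Schur_Decomposition"
begin

(* Matrix indices in Jordan_Normal_Form start at 0, so the exponent (i - 1)(j - 1) of the
   1-based convention becomes i j. *)
definition fourier_matrix :: "nat \<Rightarrow> complex mat" where
  "fourier_matrix n =
     mat n n (\<lambda>(i, j). exp (2 * of_real pi * \<i> * of_nat i * of_nat j / of_nat n))"

definition is_butson :: "nat \<Rightarrow> nat \<Rightarrow> complex mat \<Rightarrow> bool" where
  "is_butson m n M \<longleftrightarrow>
     M \<in> carrier_mat n n \<and>
     (\<forall>i<n. \<forall>j<n. (M $$ (i, j)) ^ m = 1) \<and>
     M * mat_adjoint M = of_nat n \<cdot>\<^sub>m 1\<^sub>m n"

definition is_normalized :: "complex mat \<Rightarrow> bool" where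
  "is_normalized M \<longleftrightarrow>
     (\<forall>j<dim_col M. M $$ (0, j) = 1) \<and> (\<forall>i<dim_row M. M $$ (i, 0) = 1)"

definition BH :: "nat \<Rightarrow> nat \<Rightarrow> complex mat set" where
  "BH m n = {M. is_butson m n M \<and> is_normalized M}"

(* A1 and A2 are meant for even m and n only. With 0-based indices the sign of the j-th entry
   in the alternating pattern + - + - ... is (-1) ^ j. *)
definition A1 :: "nat \<Rightarrow> nat \<Rightarrow> complex mat set" where
  "A1 m n = {M \<in> BH m n.
     \<exists>x \<in> set (rows M). vec n (\<lambda>j. (-1) ^ j * x $ j) \<in> set (rows M)}"

definition A2 :: "nat \<Rightarrow> nat \<Rightarrow> complex mat set" where
  "A2 m n = {M \<in> BH m n. \<exists>i<n. \<exists>j<n.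
     (\<forall>k<n. M $$ (i, k) \<in> {1, -1}) \<and>
     (\<forall>k<n. M $$ (k, j) \<in> {1, -1}) \<and>
     M $$ (i, j) = -1}"

end

theory Submission
  imports Defs
begin

text \<open>Row \<open>i\<close> lists the powers of a single n-th root of unity, so the inner
  product of rows \<open>i\<close> and \<open>k\<close> is a geometric sum in the ratio of their two
  roots. It vanishes unless the roots coincide, that is, unless \<open>i = k\<close>; this makes the
  matrix Butson (\<open>fourier_matrix_BH\<close>). For n = 2d the root of row d is -1, so this row
  alternates 1, -1, ... (\<open>fourier_matrix_middle_row\<close>). It is row 0, all ones, with
  alternating signs, which gives \<open>A1\<close>. By symmetry column d is the same sign vector,
  and for odd d the two meet in (-1)^d = -1, which gives \<open>A2\<close>.\<close>

lemma fourier_matrix_index: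
  assumes "i < n" "j < n"
  shows "fourier_matrix n $$ (i, j) = cis (2 * pi * real i / real n) ^ j"
proof -
  have "exp (2 * of_real pi * \<i> * of_nat i * of_nat j / of_nat n) =
        cis (real j * (2 * pi * real i / real n))"
    unfolding cis_conv_exp by (rule arg_cong[where f = exp]) (simp add: field_simps)
  then show ?thesis
    using assms by (simp add: fourier_matrix_def Complex.DeMoivre)
qed

text \<open>For z \<noteq> 1 the sum is (z^n - 1)/(z - 1), whose numerator vanishes.\<close>

lemma sum_powers_root_of_unity:
  fixes z :: complex
  assumes "z ^ n = 1"
  shows "(\<Sum>k<n. z ^ k) = (if z = 1 then of_nat n else 0)"
  using assms by (simp add: geometric_sum)

lemma dim_fourier_matrix [simp]:
  "dim_row (fourier_matrix n) = n" "dim_col (fourier_matrix n) = n"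
  by (simp_all add: fourier_matrix_def)

lemma fourier_matrix_mult_adjoint:
  "fourier_matrix n * mat_adjoint (fourier_matrix n) = of_nat n \<cdot>\<^sub>m 1\<^sub>m n"
proof (rule eq_matI)
  fix i k
  assume "i < dim_row (of_nat n \<cdot>\<^sub>m 1\<^sub>m n :: complex mat)"
    and "k < dim_col (of_nat n \<cdot>\<^sub>m 1\<^sub>m n :: complex mat)"
  then have ik: "i < n" "k < n" by auto
  define w where "w l = cis (2 * pi * real l / real n)" for l :: nat
  define z where "z = w i * cnj (w k)"
  \<comment> \<open>The map \<open>w\<close> enumerates the n-th roots of unity bijectively on
    indices below \<open>n\<close>.\<close>
  have w_inj: "w i = w k \<longleftrightarrow> i = k"
    using bij_betw_roots_unity[of n] ik
    by (auto simp: w_def bij_betw_def inj_on_def)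
  \<comment> \<open>On the unit circle conjugation is inversion, so \<open>z\<close> is the quotient
    of \<open>w i\<close> by \<open>w k\<close>.\<close>
  have "w k * cnj (w k) = 1"
    by (simp add: w_def cis_cnj cis_mult)
  then have "w i = z * w k"
    by (simp add: z_def mult.assoc mult.commute)
  moreover have "w k \<noteq> 0"
    by (simp add: w_def)
  ultimately have z1: "z = 1 \<longleftrightarrow> i = k"
    using w_inj by auto
  have wn: "w l ^ n = 1" if "l < n" for l
    using bij_betw_roots_unity[of n] that by (auto simp: w_def bij_betw_def)
  have zn: "z ^ n = 1"
    using wn ik by (simp add: z_def power_mult_distrib flip: complex_cnj_power)
  have "(fourier_matrix n * mat_adjoint (fourier_matrix n)) $$ (i, k) =
        (\<Sum>j<n. w i ^ j * cnj (w k ^ j))"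
    using ik
    by (simp add: mat_adjoint_def mat_of_rows_def scalar_prod_def fourier_matrix_index w_def
        atLeast0LessThan)
  also have "\<dots> = (\<Sum>j<n. z ^ j)"
    by (simp add: z_def power_mult_distrib)
  also have "\<dots> = (of_nat n \<cdot>\<^sub>m 1\<^sub>m n) $$ (i, k)"
    using sum_powers_root_of_unity[OF zn] z1 ik by auto
  finally show "(fourier_matrix n * mat_adjoint (fourier_matrix n)) $$ (i, k) =
    (of_nat n \<cdot>\<^sub>m 1\<^sub>m n) $$ (i, k)" .
qed (simp_all add: mat_adjoint_def)

lemma fourier_matrix_BH: "fourier_matrix n \<in> BH n n"
proof -
  have "(fourier_matrix n $$ (i, j)) ^ n = 1" if "i < n" "j < n" for i j
  proof -
    have "cis (2 * pi * real i / real n) ^ n = 1"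
      using bij_betw_roots_unity[of n] that by (auto simp: bij_betw_def)
    then show ?thesis
      \<comment> \<open>The exponents are swapped: (w^j)^n = (w^n)^j = 1.\<close>
      using that by (simp add: fourier_matrix_index flip: power_mult)
        (simp add: power_mult mult.commute[of j])
  qed
  then show ?thesis
    by (auto simp: BH_def is_butson_def is_normalized_def fourier_matrix_mult_adjoint
        fourier_matrix_index)
qed

text \<open>The angle of row d is 2 pi d / (2d) = pi, and \<open>cis pi = -1\<close>.\<close>

lemma fourier_matrix_middle_row:
  assumes "n = 2 * d" "d > 0" "j < n"
  shows "fourier_matrix n $$ (d, j) = (-1) ^ j"
  using assms by (simp add: fourier_matrix_index)

lemma fourier_matrix_sym:
  assumes "i < n" "j < n"
  shows "fourier_matrix n $$ (i, j) = fourier_matrix n $$ (j, i)"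
  using assms by (simp add: fourier_matrix_def mult_ac)

lemma fourier_matrix_A1:
  assumes "n = 2 * d" "d > 0"
  shows "fourier_matrix n \<in> A1 n n"
proof -
  let ?F = "fourier_matrix n"
  have d: "0 < n" "d < n" using assms by auto
  have "vec n (\<lambda>j. (-1) ^ j * row ?F 0 $ j) = row ?F d"
    using d assms by (intro eq_vecI) (auto simp: fourier_matrix_middle_row fourier_matrix_index[of 0])
  moreover have "row ?F i \<in> set (rows ?F)" if "i < n" for i
    using that by (auto simp: rows_def)
  ultimately show ?thesis
    using d fourier_matrix_BH by (auto simp: A1_def intro!: bexI[of _ "row ?F 0"])
qed

lemma fourier_matrix_A2:
  assumes "n = 2 * d" "odd d"
  shows "fourier_matrix n \<in> A2 n n"
proof -
  let ?F = "fourier_matrix n"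
  have d: "d > 0" "d < n" using assms by (auto intro: odd_pos)
  have row: "?F $$ (d, k) = (-1) ^ k" if "k < n" for k
    using fourier_matrix_middle_row[OF assms(1) d(1) that] .
  have col: "?F $$ (k, d) = (-1) ^ k" if "k < n" for k
    using row[OF that] fourier_matrix_sym[OF that d(2)] by simp
  have sign: "(-1) ^ k \<in> {1, -1 :: complex}" for k :: nat
    by (cases "even k") auto
  \<comment> \<open>The middle row and middle column cross here; oddness of d makes the sign
    negative.\<close>
  have "?F $$ (d, d) = -1"
    using row[OF d(2)] assms(2) by simp
  then show ?thesis
    unfolding A2_def using fourier_matrix_BH d(2) row col sign
    by (intro CollectI conjI exI[of _ d]) simp_all
qed

theorem lemma1:
  fixes n :: nat
  assumes "n \<ge> 2" and "even n"
  shows "fourier_matrix n \<in> A1 n n \<and>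
         (\<forall>d. odd d \<and> n = 2 * d \<longrightarrow> fourier_matrix n \<in> A2 n n)"
proof -
  obtain d where "n = 2 * d" using assms(2) by (auto elim: evenE)
  then have "fourier_matrix n \<in> A1 n n"
    using assms(1) by (intro fourier_matrix_A1[of n d]) auto
  then show ?thesis
    using fourier_matrix_A2 by blast
qed

end
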